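(* Let $n,d\in\mathbb{N}$, $k,s\in\mathbb{Z}$ be such that $d\mid n$ and $\nu_p(n)\ge\nu_p(k)+2$ for all primes $p\mid n$. Then $$T_n(k,s,d)=\begin{cases}\displaystyle \frac{n}{d}\, e(ks/n), & \text{if } \frac{n}{d}\mid k \text{ and } (s,d)=1,\\ 0, & \text{otherwise}.\end{cases}$$
   Context: $\mathbb{N}=\{1,2,\ldots\}$; $(a,b)$ is the greatest common divisor of $a,b\in\mathbb{Z}$; $e(x)=e^{2\pi i x}$ for $x\in\mathbb{R}$; $\nu_p(n)$ is the exponent of the prime $p$ in the prime factorization of $n\in\mathbb{Z}$, with the convention $\nu_p(0)=\infty$. For $n,d\in\mathbb{N}$ and $k,s\in\mathbb{Z}$, $$T_n(k,s,d):=\sum_{\substack{a=1\\ (a,n)=1\\ a\equiv s\ (\mathrm{mod}\ d)}}^n e(ak/n).$$ *)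

theory Defs
  imports "HOL-Number_Theory.Number_Theory" "HOL-Library.Extended_Nat" Complex_Main
begin

definition exp_unit :: "real \<Rightarrow> complex" where
  "exp_unit x = exp (2 * of_real pi * \<i> * of_real x)"

text \<open>The library sets \<open>multiplicity p 0 = 0\<close>; the convention here is that the valuation of zero
  is infinite, so it takes values in \<^typ>\<open>enat\<close>.\<close>

definition nu :: "nat \<Rightarrow> int \<Rightarrow> enat" where
  "nu p n = (if n = 0 then \<infinity> else enat (multiplicity (int p) n))"

definition T :: "nat \<Rightarrow> int \<Rightarrow> int \<Rightarrow> nat \<Rightarrow> complex" where
  "T n k s d =
     (\<Sum>a | a \<in> {1..n} \<and> gcd a n = 1 \<and> [int a = s] (mod int d). exp_unit (real a * of_int k / real n))"

end

theory Submission imports Defs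
begin

text \<open>
  The hypothesis on valuations says that \<open>k\<close> is divisible, at each prime \<open>p\<close> dividing \<open>n\<close>, by at
  least two fewer powers of \<open>p\<close> than \<open>n\<close>. Put \<open>m = n / d\<close>. If \<open>(s, d) > 1\<close>, no \<open>a\<close> prime to \<open>n\<close>
  can be congruent to \<open>s\<close> modulo \<open>d\<close> and the sum is empty. Suppose then that \<open>(s, d) = 1\<close>.

  If \<open>m\<close> divides \<open>k\<close>, then \<open>d\<close> absorbs the surplus powers, so \<open>d\<close> has the same prime divisors as \<open>n\<close>
  (lemma \<open>prime_dvd_factor_of_surplus\<close>). The condition \<open>(a, n) = 1\<close> then follows from
  \<open>a \<equiv> s (mod d)\<close>; and \<open>e(ak/n)\<close> depends only on \<open>a\<close> modulo \<open>d\<close>. All \<open>n / d\<close> terms are equal to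
  \<open>e(ks/n)\<close>.

  If \<open>m\<close> does not divide \<open>k\<close>, some prime power \<open>q = p\<^sup>v\<^sup>+\<^sup>1\<close>, where \<open>v\<close> is the valuation of \<open>k\<close> at \<open>p\<close>,
  divides \<open>m\<close> but not \<open>k\<close>. Put \<open>t = n / q\<close>. This is a multiple of \<open>d\<close>, and since \<open>p\<^sup>v\<^sup>+\<^sup>2\<close> divides
  \<open>n\<close> it still has all the prime divisors of \<open>n\<close> (lemma \<open>shift_exists\<close>). So \<open>a \<mapsto> a + t\<close> permutes
  the residues modulo \<open>n\<close> over which the sum ranges, and multiplies every term by
  \<open>e(tk/n) = e(k/q) \<noteq> 1\<close>. A sum equal to itself times a number other than 1 vanishes.
\<close>

section \<open>The additive character\<close>

lemma exp_unit_add: "exp_unit (x + y) = exp_unit x * exp_unit y"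
  by (simp add: exp_unit_def ring_distribs exp_add)

lemma exp_unit_eq_1_iff: "exp_unit x = 1 \<longleftrightarrow> x \<in> \<int>"
proof -
  have "exp_unit x = cis (2 * pi * x)"
    by (simp add: exp_unit_def cis_conv_exp mult_ac)
  then have "exp_unit x = 1 \<longleftrightarrow> cos (2 * pi * x) = 1"
    using cos_one_sin_zero[of "2 * pi * x"] by (auto simp: complex_eq_iff)
  also have "\<dots> \<longleftrightarrow> (\<exists>j::int. x = of_int j)"
    by (simp add: cos_one_2pi_int)
  finally show ?thesis
    by (auto simp: Ints_def)
qed

lemma exp_unit_fraction_eq_1_iff:
  fixes c :: int and n :: nat
  assumes "n > 0"
  shows "exp_unit (of_int c / real n) = 1 \<longleftrightarrow> int n dvd c"
proof
  assume "exp_unit (of_int c / real n) = 1"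
  then obtain j :: int where "of_int c / real n = of_int j"
    unfolding exp_unit_eq_1_iff by (auto simp: Ints_def)
  then have "real_of_int c = real_of_int (j * int n)"
    using assms by (simp add: field_simps)
  then have "c = j * int n"
    by (simp only: of_int_eq_iff)
  then show "int n dvd c"
    by simp
next
  assume "int n dvd c"
  then show "exp_unit (of_int c / real n) = 1"
    unfolding exp_unit_eq_1_iff using assms by (auto elim!: dvdE)
qed

lemma exp_unit_fraction_cong:
  fixes b c :: int and n :: nat
  assumes "n > 0" and "int n dvd b - c"
  shows "exp_unit (of_int b / real n) = exp_unit (of_int c / real n)"
proof -
  have "exp_unit (of_int b / real n) =
      exp_unit (of_int c / real n + of_int (b - c) / real n)"
    by (simp add: diff_divide_distrib)
  also have "\<dots> = exp_unit (of_int c / real n)"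
    using exp_unit_fraction_eq_1_iff[OF assms(1), of "b - c"] assms(2) by (simp add: exp_unit_add)
  finally show ?thesis .
qed

section \<open>Sums over a full period and residue classes\<close>

lemma sum_periodic_shift:
  fixes f :: "nat \<Rightarrow> complex"
  assumes "\<And>a. f (a + n) = f a"
  shows "(\<Sum>a\<in>{1..n}. f (a + t)) = sum f {1..n}"
proof (induction t)
  case (Suc t)
  \<comment> \<open>Shifting by one step replaces the first summand by the one just past the end, a period later.\<close>
  have "(\<Sum>a\<in>{1..N}. f (a + Suc t)) + f (1 + t) = (\<Sum>a\<in>{1..N}. f (a + t)) + f (1 + t + N)" for N
    by (induction N) (simp_all add: algebra_simps)
  then have "(\<Sum>a\<in>{1..n}. f (a + Suc t)) = (\<Sum>a\<in>{1..n}. f (a + t))"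
    using assms[of "1 + t"] by (metis add_right_cancel)
  then show ?case
    using Suc.IH by simp
qed simp

lemma card_residue_class:
  fixes d m :: nat and s :: int
  assumes "d > 0"
  shows "card {a \<in> {1..d * m}. [int a = s] (mod int d)} = m"
proof -
  \<comment> \<open>The representative of the class in \<open>{1..d}\<close>, matching the range of summation.\<close>
  define r where "r = Suc (nat ((s - 1) mod int d))"
  have r: "1 \<le> r" "r \<le> d" "int r = (s - 1) mod int d + 1"
    using assms by (auto simp: r_def Suc_le_eq nat_less_iff)
  have "[int r = s] (mod int d)"
    unfolding r(3) by (simp add: cong_def mod_simps)
  then have class_eq: "[int a = s] (mod int d) \<longleftrightarrow> [a = r] (mod d)" for a
    by (metis cong_int_iff cong_sym cong_trans)
  have "{a \<in> {1..d * m}. [int a = s] (mod int d)} = (\<lambda>j. j * d + r) ` {..<m}"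
  proof (intro equalityI subsetI)
    fix a assume a: "a \<in> {a \<in> {1..d * m}. [int a = s] (mod int d)}"
    then have c: "[a = r] (mod d)" and le: "1 \<le> a" "a \<le> d * m"
      by (auto simp: class_eq)
    have "r \<le> a"
    proof (rule ccontr)
      assume "\<not> r \<le> a"
      then have "d dvd r - a"
        using c by (metis cong_altdef_nat cong_sym nat_le_linear)
      moreover have "0 < r - a" "r - a < d"
        using \<open>\<not> r \<le> a\<close> le r by auto
      ultimately show False
        using dvd_imp_le by fastforce
    qed
    then obtain j where "a = j * d + r"
      using c by (metis cong_altdef_nat dvdE le_add_diff_inverse2 mult.commute)
    moreover have "j < m"
    proof -
      have "j * d < j * d + r"
        using r by simp
      also have "\<dots> \<le> m * d"
        using \<open>a = j * d + r\<close> le by (simp add: mult.commute)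
      finally have "j * d < m * d" .
      then show ?thesis
        by simp
    qed
    ultimately show "a \<in> (\<lambda>j. j * d + r) ` {..<m}"
      by auto
  next
    fix a assume "a \<in> (\<lambda>j. j * d + r) ` {..<m}"
    then obtain j where j: "j < m" "a = j * d + r"
      by auto
    have "Suc j * d \<le> m * d"
      using j by (intro mult_right_mono) auto
    then have "a \<le> d * m"
      using j r by (simp add: mult.commute)
    then show "a \<in> {a \<in> {1..d * m}. [int a = s] (mod int d)}"
      using j r(1) \<open>[int r = s] (mod int d)\<close> by (simp add: cong_def)
  qed
  moreover have "inj_on (\<lambda>j. j * d + r) {..<m}"
    using assms by (auto simp: inj_on_def)
  ultimately show ?thesis
    by (simp add: card_image)
qed

section \<open>Divisors that keep all the primes\<close>

lemma coprime_iff_coprime_same_primes: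
  fixes a n t :: nat
  assumes "t dvd n" and "\<And>p. prime p \<Longrightarrow> p dvd n \<Longrightarrow> p dvd t"
  shows "coprime a n \<longleftrightarrow> coprime a t"
proof
  show "coprime a n \<Longrightarrow> coprime a t"
    using assms(1) by (metis coprime_divisors dvd_refl)
  assume "coprime a t"
  show "coprime a n"
  proof (rule ccontr)
    assume "\<not> coprime a n"
    then obtain p where "prime p" "p dvd a" "p dvd n"
      by (metis coprime_iff_gcd_eq_1 gcd_greatest_iff prime_factor_nat)
    then show False
      using assms(2) \<open>coprime a t\<close> by (metis coprime_common_divisor not_prime_unit)
  qed
qed

text \<open>An infinite valuation of \<open>k\<close> would exceed that of \<open>n\<close>, so the valuation inequality becomes a
  divisibility statement with an ordinary exponent.\<close>

lemma valuation_gap: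
  fixes n :: nat
  assumes "n > 0" and "prime p" and "nu p (int n) \<ge> nu p k + 2"
  shows "k \<noteq> 0" and "p ^ (multiplicity (int p) k + 2) dvd n"
proof -
  show k: "k \<noteq> 0"
    using assms by (auto simp: nu_def)
  have "enat (multiplicity (int p) k + 2) \<le> enat (multiplicity (int p) (int n))"
    using assms k by (simp add: nu_def numeral_eq_enat del: enat_ord_simps)
  then have "int p ^ (multiplicity (int p) k + 2) dvd int n"
    by (intro multiplicity_dvd') simp
  then show "p ^ (multiplicity (int p) k + 2) dvd n"
    by (metis of_nat_dvd_iff of_nat_power)
qed

lemma not_power_Suc_multiplicity_dvd:
  fixes k :: int
  assumes "prime p" and "k \<noteq> 0"
  shows "\<not> int (p ^ Suc (multiplicity (int p) k)) dvd k"
proof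
  assume "int (p ^ Suc (multiplicity (int p) k)) dvd k"
  then have "Suc (multiplicity (int p) k) \<le> multiplicity (int p) k"
    using assms by (intro multiplicity_geI) auto
  then show False
    by simp
qed

text \<open>Otherwise \<open>p\<close> would be prime to \<open>d\<close>, and the large power of \<open>p\<close> in \<open>d * m\<close> would already
  divide \<open>m\<close> and hence \<open>k\<close>.\<close>

lemma prime_dvd_factor_of_surplus:
  fixes d m :: nat
  assumes "d * m > 0" and "prime p" and "nu p (int (d * m)) \<ge> nu p k + 2" and "int m dvd k"
  shows "p dvd d"
proof (rule ccontr)
  assume "\<not> p dvd d"
  let ?v = "multiplicity (int p) k"
  note gap = valuation_gap[OF assms(1-3)]
  have "coprime (p ^ (?v + 2)) d"
    using \<open>\<not> p dvd d\<close> \<open>prime p\<close> by (intro coprime_power_left_iff[THEN iffD2] disjI1 prime_imp_coprime)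
  then have "p ^ (?v + 2) dvd m"
    using gap(2) by (simp add: coprime_dvd_mult_right_iff)
  then have "p ^ Suc ?v dvd m"
    by (rule dvd_trans[rotated]) (simp add: le_imp_power_dvd)
  then have "int (p ^ Suc ?v) dvd k"
    using assms(4) by (meson dvd_trans of_nat_dvd_iff)
  with not_power_Suc_multiplicity_dvd[OF assms(2) gap(1)] show False
    by simp
qed

text \<open>The shift is \<open>t = n / p\<^sup>v\<^sup>+\<^sup>1\<close> for a prime \<open>p\<close> at which \<open>m\<close> has a larger valuation than the
  valuation \<open>v\<close> of \<open>k\<close>. The gap of two, rather than one, is what leaves a factor \<open>p\<close> in \<open>t\<close>.\<close>

lemma shift_exists:
  fixes d m :: nat
  assumes "d * m > 0"
    and gap: "\<And>p. prime p \<Longrightarrow> p dvd d * m \<Longrightarrow> nu p (int (d * m)) \<ge> nu p k + 2"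
    and "\<not> int m dvd k"
  obtains t where "d dvd t" and "t dvd d * m"
    and "\<And>p. prime p \<Longrightarrow> p dvd d * m \<Longrightarrow> p dvd t"
    and "\<not> int (d * m) dvd int t * k"
proof -
  have "k \<noteq> 0"
    using assms(3) by auto
  have "int m \<noteq> 0"
    using assms(1) by auto
  then have "\<exists>p'. prime p' \<and> \<not> multiplicity p' (int m) \<le> multiplicity p' k"
    using assms(3) multiplicity_le_imp_dvd[of "int m" k] by blast
  then obtain p' :: int where p': "prime p'" "multiplicity p' k < multiplicity p' (int m)"
    by (auto simp: not_le)
  define p where "p = nat p'"
  have p: "prime p" "int p = p'"
    using p'(1) by (simp_all add: p_def prime_ge_0_int)
  define q where "q = p ^ Suc (multiplicity p' k)"
  have "int q dvd int m"
    using p'(2) by (simp add: q_def p multiplicity_dvd' del: power_Suc)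
  then obtain r where r: "m = q * r"
    by (meson dvdE of_nat_dvd_iff)
  have "p dvd d * m"
    by (simp add: r q_def)
  then have "p ^ (multiplicity p' k + 2) dvd d * m"
    using valuation_gap(2)[OF assms(1) p(1) gap[OF p(1)]] by (simp add: p)
  moreover have "p ^ (multiplicity p' k + 2) = q * p" "d * m = q * (d * r)"
    by (simp_all add: q_def r)
  moreover have "q \<noteq> 0"
    using assms(1) r by auto
  ultimately have pdvd: "p dvd d * r"
    by (metis dvd_times_left_cancel_iff)
  show ?thesis
  proof
    show "d dvd d * r" "d * r dvd d * m"
      by (simp_all add: r)
    show "p1 dvd d * r" if "prime p1" "p1 dvd d * m" for p1
    proof (cases "p1 dvd q")
      case True
      then have "p1 = p"
        using that(1) p(1) unfolding q_def by (metis prime_dvd_power primes_dvd_imp_eq)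
      then show ?thesis
        using pdvd by simp
    next
      case False
      then show ?thesis
        using that by (auto simp: r prime_dvd_mult_iff)
    qed
    have "\<not> int q dvd k"
      using not_power_Suc_multiplicity_dvd[OF p(1) \<open>k \<noteq> 0\<close>] by (simp add: q_def p del: power_Suc)
    moreover have "int (d * m) = int (d * r) * int q" "int (d * r) \<noteq> 0"
      using assms(1) by (auto simp: r)
    ultimately show "\<not> int (d * m) dvd int (d * r) * k"
      by (metis dvd_times_left_cancel_iff)
  qed
qed

section \<open>Evaluation of the sum\<close>

lemma T_not_coprime_eq_0:
  assumes "d dvd n" and "gcd s (int d) \<noteq> 1"
  shows "T n k s d = 0"
proof -
  have False if "gcd a n = 1" "[int a = s] (mod int d)" for a
  proof -
    have "coprime (int a) (int n)"
      using that(1) by (metis coprime_iff_gcd_eq_1 coprime_int_iff)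
    then have "coprime (int a) (int d)"
      using assms(1) by (meson coprime_divisors dvd_refl of_nat_dvd_iff)
    then have "coprime s (int d)"
      using that(2) cong_imp_coprime by blast
    then show False
      using assms(2) by (metis coprime_iff_gcd_eq_1)
  qed
  then show ?thesis
    unfolding T_def by (intro sum.neutral) (metis (mono_tags, lifting) mem_Collect_eq)
qed

text \<open>The summand, extended by zero, has period \<open>n\<close>, so shifting it by \<open>t\<close> does not change its sum.
  Because \<open>t\<close> is a multiple of \<open>d\<close> and has all the primes of \<open>n\<close>, the shift respects both
  conditions on \<open>a\<close>, and its only effect is a constant factor different from 1.\<close>

lemma T_eq_0_of_shift:
  assumes "n > 0" and "d dvd n" and "d dvd t" and "t dvd n"
    and primes: "\<And>p. prime p \<Longrightarrow> p dvd n \<Longrightarrow> p dvd t"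
    and "\<not> int n dvd int t * k"
  shows "T n k s d = 0"
proof -
  define f where "f a = (if gcd a n = 1 \<and> [int a = s] (mod int d)
      then exp_unit (real a * of_int k / real n) else 0)" for a
  have T_eq: "T n k s d = sum f {1..n}"
    unfolding T_def f_def by (rule sum.mono_neutral_cong_left) auto
  have class_shift: "[int (a + t) = s] (mod int d) \<longleftrightarrow> [int a = s] (mod int d)" if "d dvd t" for a t
    using that by (auto simp: cong_def elim!: dvdE)
  have exp_shift: "exp_unit (real (a + t) * of_int k / real n) =
      exp_unit (of_int (int t * k) / real n) * exp_unit (real a * of_int k / real n)" for a t
    by (simp add: exp_unit_add[symmetric] ring_distribs add_divide_distrib add.commute)
  have "f (a + n) = f a" for a
    using exp_unit_fraction_eq_1_iff[OF assms(1), of "int n * k"]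
    unfolding f_def class_shift[OF assms(2)] exp_shift by simp
  then have "T n k s d = (\<Sum>a\<in>{1..n}. f (a + t))"
    unfolding T_eq by (rule sum_periodic_shift[symmetric])
  also have "\<dots> = exp_unit (of_int (int t * k) / real n) * T n k s d"
  proof -
    have "coprime (a + t) n \<longleftrightarrow> coprime a n" for a
      using coprime_iff_coprime_same_primes[OF assms(4) primes]
      by (metis coprime_iff_gcd_eq_1 gcd_add1)
    then have "gcd (a + t) n = 1 \<longleftrightarrow> gcd a n = 1" for a
      by (metis coprime_iff_gcd_eq_1)
    then have "f (a + t) = exp_unit (of_int (int t * k) / real n) * f a" for a
      unfolding f_def class_shift[OF assms(3)] exp_shift by simp
    then show ?thesis
      by (simp add: T_eq sum_distrib_left)
  qed
  finally show ?thesis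
    using exp_unit_fraction_eq_1_iff[OF assms(1), of "int t * k"] assms(6) by simp
qed

text \<open>When \<open>d\<close> has all the primes of \<open>d * m\<close>, the congruence alone forces \<open>a\<close> to be prime to
  \<open>d * m\<close>, and the range of summation is a full residue class, on which the summand is constant.\<close>

lemma T_eq_of_same_primes:
  fixes d m :: nat
  assumes "d * m > 0" and primes: "\<And>p. prime p \<Longrightarrow> p dvd d * m \<Longrightarrow> p dvd d"
    and "int m dvd k" and "gcd s (int d) = 1"
  shows "T (d * m) k s d = of_nat m * exp_unit (of_int k * of_int s / real (d * m))"
proof -
  let ?C = "{a \<in> {1..d * m}. [int a = s] (mod int d)}"
  have "gcd a (d * m) = 1" if "[int a = s] (mod int d)" for a
  proof -
    have "coprime (int a) (int d)"
      using that assms(4) by (metis cong_imp_coprime cong_sym coprime_iff_gcd_eq_1)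
    then have "coprime a (d * m)"
      using coprime_iff_coprime_same_primes[OF dvd_triv_left primes] by (metis coprime_int_iff)
    then show ?thesis
      by (metis coprime_iff_gcd_eq_1)
  qed
  then have index: "{a. a \<in> {1..d * m} \<and> gcd a (d * m) = 1 \<and> [int a = s] (mod int d)} = ?C"
    by blast
  have const: "exp_unit (real a * of_int k / real (d * m)) =
      exp_unit (of_int k * of_int s / real (d * m))"
    if "[int a = s] (mod int d)" for a
  proof -
    have "int d dvd int a - s"
      using that by (simp add: cong_iff_dvd_diff)
    then have "int (d * m) dvd (int a - s) * k"
      unfolding of_nat_mult using assms(3) by (rule mult_dvd_mono)
    then have "int (d * m) dvd int a * k - k * s"
      by (simp add: algebra_simps)
    then show ?thesis
      using exp_unit_fraction_cong[OF assms(1)] by fastforce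
  qed
  have "T (d * m) k s d = (\<Sum>a\<in>?C. exp_unit (of_int k * of_int s / real (d * m)))"
    unfolding T_def index by (intro sum.cong refl const) auto
  also have "\<dots> = of_nat m * exp_unit (of_int k * of_int s / real (d * m))"
    using card_residue_class[of d m s] assms(1) by simp
  finally show ?thesis .
qed

theorem lemma4p2:
  fixes n d :: nat and k s :: int
  assumes "n \<ge> 1" and "d \<ge> 1"
    and "d dvd n"
    and "\<And>p. prime p \<Longrightarrow> p dvd n \<Longrightarrow> nu p (int n) \<ge> nu p k + 2"
  shows "T n k s d =
    (if int (n div d) dvd k \<and> gcd s (int d) = 1
     then of_nat (n div d) * exp_unit (of_int k * of_int s / real n)
     else 0)"
proof -
  define m where "m = n div d"
  have n: "n = d * m"
    using assms(3) by (simp add: m_def)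
  have pos: "d * m > 0"
    using assms(1) n by simp
  have gap: "nu p (int (d * m)) \<ge> nu p k + 2" if "prime p" "p dvd d * m" for p
    using assms(4) that n by blast
  consider (not_coprime) "gcd s (int d) \<noteq> 1"
    | (dvd) "gcd s (int d) = 1" "int m dvd k" | (not_dvd) "\<not> int m dvd k"
    by metis
  then show ?thesis
    unfolding m_def[symmetric]
  proof cases
    case not_coprime
    then show "T n k s d = (if int m dvd k \<and> gcd s (int d) = 1
        then of_nat m * exp_unit (of_int k * of_int s / real n) else 0)"
      using T_not_coprime_eq_0[OF assms(3)] by simp
  next
    case dvd
    have "p dvd d" if "prime p" "p dvd d * m" for p
      using prime_dvd_factor_of_surplus[OF pos that(1) gap[OF that] dvd(2)] .
    then show "T n k s d = (if int m dvd k \<and> gcd s (int d) = 1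
        then of_nat m * exp_unit (of_int k * of_int s / real n) else 0)"
      using T_eq_of_same_primes[OF pos _ dvd(2,1)] dvd unfolding n by simp
  next
    case not_dvd
    obtain t where "d dvd t" "t dvd d * m" "\<And>p. prime p \<Longrightarrow> p dvd d * m \<Longrightarrow> p dvd t"
      "\<not> int (d * m) dvd int t * k"
      using shift_exists[OF pos gap not_dvd] by blast
    then have "T n k s d = 0"
      unfolding n by (intro T_eq_0_of_shift[OF pos dvd_triv_left])
    then show "T n k s d = (if int m dvd k \<and> gcd s (int d) = 1
        then of_nat m * exp_unit (of_int k * of_int s / real n) else 0)"
      using not_dvd by simp
  qed
qed

end
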